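(* Let $W=\{W(t):t\in[a,b]\}$ be a Brownian motion, and for $f,h\in H_1$ let $$\varepsilon(f,h):=-\int_a^b f'(t)h'(t)\,dt+\int_a^b f(t)h'(t)W(t)\,dt.$$ Write $\varepsilon=\varepsilon_1+\varepsilon_2$ with $$\varepsilon_1(f,h):=-\frac12\int_a^b f'h'\,dt+\frac12\int_a^b f h' W\,dt+\frac12\int_a^b f' h W\,dt,$$ $$\varepsilon_2(f,h):=-\frac12\int_a^b f'h'\,dt+\frac12\int_a^b f h' W\,dt-\frac12\int_a^b f' h W\,dt.$$ Then there exist operators $L_1$ and $L_2$ with domain $H_1$ such that $\varepsilon_1(f,g)=\langle L_1f,g\rangle_1$ and $\varepsilon_2(f,g)=\langle L_2f,g\rangle_1$ for all $f,g\in H_1$; hence the bilinear form $\varepsilon$ is associated with the operator $L_1+L_2$, that is, $\varepsilon(f,g)=\langle (L_1+L_2)f,g\rangle_1$ for all $f,g\in H_1$.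
   Context: Fix real numbers $a<b$ and a Brownian motion $W=\{W(t):t\in[a,b]\}$ with continuous paths; the forms and operators are considered for each fixed (continuous) path of $W$. $H_1$ is the Sobolev space of absolutely continuous functions $h:[a,b]\to\mathbb{R}$ with $h,h'\in L_2[a,b]$ and $h(a)=h(b)=0$, a Hilbert space with inner product $\langle f,g\rangle_1=\int_a^b f(x)g(x)\,dx+\int_a^b f'(x)g'(x)\,dx$. The form $\varepsilon$ is the weak version of the formal operator $f\mapsto f''-Wf'-W'f$. *)

theory Defs
  imports "HOL-Probability.Probability"
begin

text \<open>
  The law of the starting value \<open>W a\<close> is left free and no time is singled out where \<open>W\<close> vanishes:
  \<open>a\<close> and \<open>b\<close> are arbitrary reals, and both a process started at time \<open>a\<close> and the restriction of
  a one- or two-sided standard Brownian motion are covered.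
\<close>

definition brownian_motion_on ::
    "'w measure \<Rightarrow> real \<Rightarrow> real \<Rightarrow> (real \<Rightarrow> 'w \<Rightarrow> real) \<Rightarrow> bool" where
  "brownian_motion_on M a b W \<longleftrightarrow>
     prob_space M \<and>
     (\<forall>t\<in>{a..b}. W t \<in> borel_measurable M) \<and>
     (\<forall>n (t :: nat \<Rightarrow> real). a \<le> t 0 \<and> (\<forall>i<n. t i < t (Suc i)) \<and> t n \<le> b \<longrightarrow>
        prob_space.indep_vars M (\<lambda>_. borel) (\<lambda>i \<omega>. W (t (Suc i)) \<omega> - W (t i) \<omega>) {..<n}) \<and>
     (\<forall>s t. a \<le> s \<and> s < t \<and> t \<le> b \<longrightarrow>
        distributed M lborel (\<lambda>\<omega>. W t \<omega> - W s \<omega>) (normal_density 0 (sqrt (t - s)))) \<and>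
     (\<forall>\<omega>\<in>space M. continuous_on {a..b} (\<lambda>t. W t \<omega>))"

text \<open>
  The usual \<open>\<epsilon>\<close>-\<open>\<delta>\<close> definition: \<open>D\<close> ranges over the finite families of non-overlapping compact
  subintervals \<open>k = {x..y}\<close> of \<open>[a,b]\<close>, for which \<open>Inf k = x\<close> and \<open>Sup k = y\<close>.
\<close>

definition abs_cont_on :: "real \<Rightarrow> real \<Rightarrow> (real \<Rightarrow> real) \<Rightarrow> bool" where
  "abs_cont_on a b f \<longleftrightarrow>
     (\<forall>\<epsilon>>0. \<exists>\<delta>>0. \<forall>D S. D division_of S \<and> S \<subseteq> {a..b} \<and> (\<Sum>k\<in>D. Sup k - Inf k) < \<delta> \<longrightarrow>
        (\<Sum>k\<in>D. \<bar>f (Sup k) - f (Inf k)\<bar>) < \<epsilon>)"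

definition L2_on :: "real \<Rightarrow> real \<Rightarrow> (real \<Rightarrow> real) \<Rightarrow> bool" where
  "L2_on a b f \<longleftrightarrow> f \<in> borel_measurable (lebesgue_on {a..b}) \<and>
                   integrable (lebesgue_on {a..b}) (\<lambda>x. (f x)\<^sup>2)"

text \<open>
  Functions on \<open>[a,b]\<close> are represented by their extension by \<open>0\<close> to the real line, so that equality
  in \<open>H1\<close> is equality of functions and linear combinations are pointwise.  The derivative \<open>h'\<close> is
  \<^term>\<open>deriv h\<close>, which has the meaning of a derivative only where \<open>h\<close> is differentiable; the
  condition that this is so almost everywhere (a consequence of absolute continuity) is what makes
  \<open>h' \<in> L\<^sub>2[a,b]\<close> meaningful.
\<close>

definition H1 :: "real \<Rightarrow> real \<Rightarrow> (real \<Rightarrow> real) set" where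
  "H1 a b = {h. abs_cont_on a b h \<and>
                L2_on a b h \<and>
                (AE x in lebesgue_on {a..b}. h differentiable (at x)) \<and>
                L2_on a b (deriv h) \<and>
                h a = 0 \<and> h b = 0 \<and> (\<forall>x. x \<notin> {a..b} \<longrightarrow> h x = 0)}"

definition H1_inner :: "real \<Rightarrow> real \<Rightarrow> (real \<Rightarrow> real) \<Rightarrow> (real \<Rightarrow> real) \<Rightarrow> real" where
  "H1_inner a b f g =
     (LINT x|lebesgue_on {a..b}. f x * g x) + (LINT x|lebesgue_on {a..b}. deriv f x * deriv g x)"

definition linear_operator_on ::
    "(real \<Rightarrow> real) set \<Rightarrow> ((real \<Rightarrow> real) \<Rightarrow> (real \<Rightarrow> real)) \<Rightarrow> bool" where
  "linear_operator_on V L \<longleftrightarrow>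
     L \<in> V \<rightarrow> V \<and>
     (\<forall>f\<in>V. \<forall>g\<in>V. L (\<lambda>x. f x + g x) = (\<lambda>x. L f x + L g x)) \<and>
     (\<forall>c. \<forall>f\<in>V. L (\<lambda>x. c * f x) = (\<lambda>x. c * L f x))"

text \<open>In the three forms below, \<open>w\<close> is a fixed path of the Brownian motion.\<close>

definition form ::
    "real \<Rightarrow> real \<Rightarrow> (real \<Rightarrow> real) \<Rightarrow> (real \<Rightarrow> real) \<Rightarrow> (real \<Rightarrow> real) \<Rightarrow> real" where
  "form a b w f h =
     - (LINT t|lebesgue_on {a..b}. deriv f t * deriv h t)
     + (LINT t|lebesgue_on {a..b}. f t * deriv h t * w t)"

definition form1 ::
    "real \<Rightarrow> real \<Rightarrow> (real \<Rightarrow> real) \<Rightarrow> (real \<Rightarrow> real) \<Rightarrow> (real \<Rightarrow> real) \<Rightarrow> real" where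
  "form1 a b w f h =
     - (1/2) * (LINT t|lebesgue_on {a..b}. deriv f t * deriv h t)
     + (1/2) * (LINT t|lebesgue_on {a..b}. f t * deriv h t * w t)
     + (1/2) * (LINT t|lebesgue_on {a..b}. deriv f t * h t * w t)"

definition form2 ::
    "real \<Rightarrow> real \<Rightarrow> (real \<Rightarrow> real) \<Rightarrow> (real \<Rightarrow> real) \<Rightarrow> (real \<Rightarrow> real) \<Rightarrow> real" where
  "form2 a b w f h =
     - (1/2) * (LINT t|lebesgue_on {a..b}. deriv f t * deriv h t)
     + (1/2) * (LINT t|lebesgue_on {a..b}. f t * deriv h t * w t)
     - (1/2) * (LINT t|lebesgue_on {a..b}. deriv f t * h t * w t)"

end

theory Submission
  imports Defs
begin

text \<open>
  Both forms are \<open>-1/2 \<integral> f' h' + 1/2 \<integral> f h' w + \<sigma> \<integral> f' h w\<close> with \<open>\<sigma> = 1/2\<close> or \<open>\<sigma> = -1/2\<close>, and the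
  representing element can be written down.  Put \<open>\<Gamma> x = \<integral>\<^sub>a\<^sup>x (\<sigma> f' w + f/2)\<close>; integrating the terms without \<open>h'\<close>
  by parts turns the form into \<open>-1/2 \<langle>f, h\<rangle>\<^sub>1 + \<integral> \<Phi> h'\<close> with \<open>\<Phi> = f w/2 - \<Gamma>\<close> continuous.  So
  \<open>L f = v - f/2\<close>, where \<open>v\<close> is the \<open>C\<^sup>1\<close> solution of \<open>v' = p + \<Phi>\<close>, \<open>p' = v\<close>, \<open>v a = v b = 0\<close>.  Splitting off
  \<open>f/2\<close> makes \<open>v\<close> differentiable everywhere, so that Lebesgue's differentiation theorem is not
  needed.  Linearity of \<open>L\<close> follows from the uniqueness of the representing element.
\<close>

section \<open>Absolutely continuous functions on a compact interval\<close>

lemma abs_cont_on_subset: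
  assumes "abs_cont_on a b f" "{c..d} \<subseteq> {a..b}"
  shows "abs_cont_on c d f"
  using assms unfolding abs_cont_on_def by (meson order_trans)

lemma abs_cont_on_lincomb:
  assumes f: "abs_cont_on a b f" and g: "abs_cont_on a b g"
  shows "abs_cont_on a b (\<lambda>x. c * f x + d * g x)"
  unfolding abs_cont_on_def
proof (intro allI impI)
  fix e :: real assume "e > 0"
  \<comment> \<open>The summand 1 keeps the denominator positive when \<open>c = d = 0\<close> and
    makes the final estimate strict.\<close>
  define e' where "e' = e / (\<bar>c\<bar> + \<bar>d\<bar> + 1)"
  have "e' > 0" using \<open>e > 0\<close> by (simp add: e'_def)
  obtain r where r: "r > 0" "\<And>D S. D division_of S \<and> S \<subseteq> {a..b} \<and> (\<Sum>k\<in>D. Sup k - Inf k) < r \<Longrightarrow>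
        (\<Sum>k\<in>D. \<bar>f (Sup k) - f (Inf k)\<bar>) < e'"
    using f \<open>e' > 0\<close> unfolding abs_cont_on_def by meson
  obtain s where s: "s > 0" "\<And>D S. D division_of S \<and> S \<subseteq> {a..b} \<and> (\<Sum>k\<in>D. Sup k - Inf k) < s \<Longrightarrow>
        (\<Sum>k\<in>D. \<bar>g (Sup k) - g (Inf k)\<bar>) < e'"
    using g \<open>e' > 0\<close> unfolding abs_cont_on_def by meson
  show "\<exists>\<delta>>0. \<forall>D S. D division_of S \<and> S \<subseteq> {a..b} \<and> (\<Sum>k\<in>D. Sup k - Inf k) < \<delta> \<longrightarrow>
        (\<Sum>k\<in>D. \<bar>c * f (Sup k) + d * g (Sup k) - (c * f (Inf k) + d * g (Inf k))\<bar>) < e"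
  proof (intro exI[of _ "min r s"] conjI allI impI)
    fix D S assume D: "D division_of S \<and> S \<subseteq> {a..b} \<and> (\<Sum>k\<in>D. Sup k - Inf k) < min r s"
    have "(\<Sum>k\<in>D. \<bar>c * f (Sup k) + d * g (Sup k) - (c * f (Inf k) + d * g (Inf k))\<bar>)
        \<le> (\<Sum>k\<in>D. \<bar>c\<bar> * \<bar>f (Sup k) - f (Inf k)\<bar> + \<bar>d\<bar> * \<bar>g (Sup k) - g (Inf k)\<bar>)"
    proof (rule sum_mono)
      fix k
      have "c * f (Sup k) + d * g (Sup k) - (c * f (Inf k) + d * g (Inf k))
          = c * (f (Sup k) - f (Inf k)) + d * (g (Sup k) - g (Inf k))"
        by (simp add: algebra_simps)
      then show "\<bar>c * f (Sup k) + d * g (Sup k) - (c * f (Inf k) + d * g (Inf k))\<bar>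
          \<le> \<bar>c\<bar> * \<bar>f (Sup k) - f (Inf k)\<bar> + \<bar>d\<bar> * \<bar>g (Sup k) - g (Inf k)\<bar>"
        by (metis abs_mult abs_triangle_ineq)
    qed
    also have "\<dots> = \<bar>c\<bar> * (\<Sum>k\<in>D. \<bar>f (Sup k) - f (Inf k)\<bar>) + \<bar>d\<bar> * (\<Sum>k\<in>D. \<bar>g (Sup k) - g (Inf k)\<bar>)"
      by (simp add: sum.distrib sum_distrib_left)
    also have "\<dots> \<le> \<bar>c\<bar> * e' + \<bar>d\<bar> * e'"
      using r(2)[of D S] s(2)[of D S] D by (intro add_mono mult_left_mono) auto
    also have "\<dots> < (\<bar>c\<bar> + \<bar>d\<bar> + 1) * e'"
      using \<open>e' > 0\<close> by (simp add: algebra_simps)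
    also have "\<dots> = e"
      using abs_ge_zero[of c] abs_ge_zero[of d] unfolding e'_def by (intro nonzero_mult_div_cancel_left[THEN trans[OF times_divide_eq_right]]) linarith
    finally show "(\<Sum>k\<in>D. \<bar>c * f (Sup k) + d * g (Sup k) - (c * f (Inf k) + d * g (Inf k))\<bar>) < e" .
  qed (use r s in auto)
qed

lemma division_of_real_memE:
  fixes D :: "real set set"
  assumes "D division_of S" "k \<in> D"
  obtains x y where "k = {x..y}" "x \<le> y" "Inf k = x" "Sup k = y" "x \<in> S" "y \<in> S"
proof -
  obtain x y where "k = cbox x y" using assms by (metis division_ofD(4))
  moreover have "k \<noteq> {}" "k \<subseteq> S" using assms by (auto dest: division_ofD)
  ultimately show thesis using that[of x y] by (auto simp: subset_iff)
qed

lemma lipschitz_on_imp_abs_cont_on: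
  assumes "\<And>x y. x \<in> {a..b} \<Longrightarrow> y \<in> {a..b} \<Longrightarrow> \<bar>f x - f y\<bar> \<le> B * \<bar>x - y\<bar>" "B > 0"
  shows "abs_cont_on a b f"
  unfolding abs_cont_on_def
proof (intro allI impI)
  fix e :: real assume "e > 0"
  show "\<exists>\<delta>>0. \<forall>D S. D division_of S \<and> S \<subseteq> {a..b} \<and> (\<Sum>k\<in>D. Sup k - Inf k) < \<delta> \<longrightarrow>
        (\<Sum>k\<in>D. \<bar>f (Sup k) - f (Inf k)\<bar>) < e"
  proof (intro exI[of _ "e / B"] conjI allI impI)
    fix D S assume D: "D division_of S \<and> S \<subseteq> {a..b} \<and> (\<Sum>k\<in>D. Sup k - Inf k) < e / B"
    have "(\<Sum>k\<in>D. \<bar>f (Sup k) - f (Inf k)\<bar>) \<le> (\<Sum>k\<in>D. B * (Sup k - Inf k))"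
    proof (rule sum_mono)
      fix k assume "k \<in> D"
      then obtain x y where "k = {x..y}" "x \<le> y" "Inf k = x" "Sup k = y" "x \<in> S" "y \<in> S"
        using D division_of_real_memE by metis
      then show "\<bar>f (Sup k) - f (Inf k)\<bar> \<le> B * (Sup k - Inf k)"
        using assms(1)[of y x] D by (auto simp: subset_iff)
    qed
    also have "\<dots> = B * (\<Sum>k\<in>D. Sup k - Inf k)" by (simp add: sum_distrib_left)
    also have "\<dots> < e" using D assms(2) by (simp add: field_simps)
    finally show "(\<Sum>k\<in>D. \<bar>f (Sup k) - f (Inf k)\<bar>) < e" .
  qed (use \<open>e > 0\<close> assms in auto)
qed

lemma abs_cont_on_imp_continuous_on:
  assumes "abs_cont_on a b f"
  shows "continuous_on {a..b} f"
  unfolding continuous_on_iff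
proof (intro ballI allI impI)
  fix x and e :: real assume x: "x \<in> {a..b}" and "e > 0"
  obtain r where r: "r > 0" "\<And>D S. D division_of S \<and> S \<subseteq> {a..b} \<and> (\<Sum>k\<in>D. Sup k - Inf k) < r \<Longrightarrow>
        (\<Sum>k\<in>D. \<bar>f (Sup k) - f (Inf k)\<bar>) < e"
    using assms \<open>e > 0\<close> unfolding abs_cont_on_def by meson
  \<comment> \<open>A single interval \<open>{u..v}\<close> is already an admissible
    division.\<close>
  have *: "\<bar>f v - f u\<bar> < e" if "u \<le> v" "u \<in> {a..b}" "v \<in> {a..b}" "v - u < r" for u v
    using r(2)[of "{{u..v}}" "{u..v}"] that division_of_self[of u v] by auto
  show "\<exists>d>0. \<forall>x'\<in>{a..b}. dist x' x < d \<longrightarrow> dist (f x') (f x) < e"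
  proof (intro exI[of _ r] conjI ballI impI)
    fix y assume "y \<in> {a..b}" "dist y x < r"
    then show "dist (f y) (f x) < e"
      using *[of x y] *[of y x] x by (cases "x \<le> y") (auto simp: dist_real_def abs_minus_commute)
  qed (use r in auto)
qed

section \<open>The fundamental theorem of calculus with a negligible exceptional set\<close>

text \<open>Bridge between absolute continuity, phrased with divisions, and the tagged partial
  divisions of the gauge integral. The intervals do not overlap, so their total length is the
  measure of their union, which is below \<open>r\<close> because the union lies in
  \<open>U\<close>.\<close>

lemma abs_cont_on_sum_tags_le:
  assumes r: "\<And>D S. D division_of S \<and> S \<subseteq> {a..b} \<and> (\<Sum>k\<in>D. Sup k - Inf k) < r \<Longrightarrow>
        (\<Sum>k\<in>D. \<bar>f (Sup k) - f (Inf k)\<bar>) < (e::real)"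
    and q: "q tagged_partial_division_of {a..b}"
    and U: "\<And>x k. (x, k) \<in> q \<Longrightarrow> k \<subseteq> U" "U \<in> lmeasurable" "measure lebesgue U < r"
  shows "(\<Sum>(x,k)\<in>q. \<bar>f (Sup k) - f (Inf k)\<bar>) < e"
proof -
  let ?S = "\<Union>(snd ` q)"
  have tq: "q tagged_division_of ?S"
    using q tagged_partial_division_of_Union_self by blast
  have div: "snd ` q division_of ?S"
    using tq division_of_tagged_division by blast
  have sub: "?S \<subseteq> {a..b}"
    using q unfolding tagged_partial_division_of_def by fastforce
  have "(\<Sum>k\<in>snd ` q. Sup k - Inf k) = (\<Sum>k\<in>snd ` q. measure lebesgue k)"
  proof (rule sum.cong)
    fix k assume "k \<in> snd ` q"
    then obtain x y where "k = {x..y}" "x \<le> y"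
      using division_of_real_memE[OF div] by metis
    then show "Sup k - Inf k = measure lebesgue k" by simp
  qed simp
  also have "\<dots> = measure lebesgue ?S"
    using content_division[OF div] by simp
  also have "\<dots> \<le> measure lebesgue U"
  proof (rule measure_mono_fmeasurable)
    show "?S \<in> sets lebesgue"
      using lmeasurable_division[OF div] by (rule fmeasurableD)
    show "?S \<subseteq> U" using U(1) by fastforce
  qed (use U in auto)
  also have "\<dots> < r" by fact
  finally have *: "(\<Sum>k\<in>snd ` q. \<bar>f (Sup k) - f (Inf k)\<bar>) < e"
    using r[of "snd ` q" ?S] div sub by blast
  \<comment> \<open>\<open>Sup {}\<close> and \<open>Inf {}\<close> are unspecified reals, hence the case distinction.\<close>
  define h where "h = (\<lambda>k. if k = {} then 0 else \<bar>f (Sup k) - f (Inf k)\<bar>)"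
  have ne: "k \<noteq> {}" if "(x,k) \<in> q" for x k
    using q that unfolding tagged_partial_division_of_def by fastforce
  have "(\<Sum>(x,k)\<in>q. \<bar>f (Sup k) - f (Inf k)\<bar>) = (\<Sum>(x,k)\<in>q. h k)"
    using ne by (intro sum.cong) (auto simp: h_def)
  also have "\<dots> = sum h (snd ` q)"
    by (rule sum.over_tagged_division_lemma[OF tq]) (auto simp: h_def)
  also have "\<dots> = (\<Sum>k\<in>snd ` q. \<bar>f (Sup k) - f (Inf k)\<bar>)"
    using ne by (intro sum.cong) (auto simp: h_def)
  finally show ?thesis using * by simp
qed

text \<open>A gauge integral argument: each Riemann sum is compared with \<open>f b - f a\<close>,
  written as the telescoping sum of the increments of \<open>f\<close>. Tags in \<open>N\<close> and
  tags outside \<open>N\<close> each contribute at most half of the tolerance. Integrability of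
  \<open>f'\<close> comes out as part of the conclusion.\<close>

lemma fundamental_theorem_of_calculus_abs_cont:
  assumes "a \<le> b" and ac: "abs_cont_on a b f" and "negligible N"
    and der: "\<And>x. x \<in> {a..b} - N \<Longrightarrow> (f has_vector_derivative f' x) (at x within {a..b})"
  shows "(f' has_integral (f b - f a)) {a..b}"
proof (cases "a = b")
  case True then show ?thesis by (simp add: has_integral_refl)
next
  case False
  with assms have "a < b" by simp
  \<comment> \<open>With the value 0 on \<open>N\<close>, an interval tagged in \<open>N\<close>
    contributes only the increment of \<open>f\<close>.\<close>
  define g where "g x = (if x \<in> N then 0 else f' x)" for x
  have "(g has_integral (f b - f a)) {a..b}"
    unfolding has_integral_factor_content_real
  proof (intro allI impI)
    fix e :: real assume "e > 0"
    \<comment> \<open>The condition on \<open>x\<close> stands inside the existential, so that the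
      choice below gives a positive \<open>d x\<close> at every point, as a gauge demands.\<close>
    have "\<forall>x. \<exists>d>0. x \<in> {a..b} - N \<longrightarrow>
         (\<forall>y\<in>{a..b}. norm (y-x) < d \<longrightarrow> norm (f y - f x - (y-x) *\<^sub>R g x) \<le> e / 2 * norm (y-x))"
    proof
      fix x
      show "\<exists>d>0. x \<in> {a..b} - N \<longrightarrow>
         (\<forall>y\<in>{a..b}. norm (y-x) < d \<longrightarrow> norm (f y - f x - (y-x) *\<^sub>R g x) \<le> e / 2 * norm (y-x))"
      proof (cases "x \<in> {a..b} - N")
        case True
        then show ?thesis
          using conjunct2[OF der[OF True, unfolded has_vector_derivative_def has_derivative_within_alt],
              rule_format, OF half_gt_zero[OF \<open>e > 0\<close>]]
          unfolding g_def by simp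
      qed (auto intro: exI[of _ 1])
    qed
    then obtain d where d: "\<And>x. 0 < d x"
                 "\<And>x y. \<lbrakk>x \<in> {a..b} - N; y \<in> {a..b}; norm (y-x) < d x\<rbrakk>
                        \<Longrightarrow> norm (f y - f x - (y-x) *\<^sub>R g x) \<le> e / 2 * norm (y-x)"
      by metis
    have "e / 2 * (b - a) > 0" using \<open>e > 0\<close> \<open>a < b\<close> by simp
    then obtain r where r: "r > 0" "\<And>D S. D division_of S \<and> S \<subseteq> {a..b} \<and> (\<Sum>k\<in>D. Sup k - Inf k) < r \<Longrightarrow>
        (\<Sum>k\<in>D. \<bar>f (Sup k) - f (Inf k)\<bar>) < e / 2 * (b - a)"
      using ac unfolding abs_cont_on_def by meson
    \<comment> \<open>\<open>N\<close> is a null set, so outer regularity gives an open superset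
      \<open>T\<close> of total measure below \<open>r\<close>.\<close>
    obtain T where T: "open T" "N \<subseteq> T" "T - N \<in> lmeasurable" "emeasure lebesgue (T - N) < ennreal r"
      using sets_lebesgue_outer_open[OF negligible_imp_sets[OF \<open>negligible N\<close>] \<open>r > 0\<close>] by blast
    have "T = (T - N) \<union> N" using T by auto
    then have lT: "T \<in> lmeasurable" and mT: "measure lebesgue T < r"
    proof -
      show "T \<in> lmeasurable"
        using fmeasurable.Un[OF T(3) negligible_imp_measurable[OF \<open>negligible N\<close>]] \<open>T = (T - N) \<union> N\<close> by simp
      have "measure lebesgue T \<le> measure lebesgue (T - N) + measure lebesgue N"
        using measure_Un_le[OF fmeasurableD[OF T(3)] negligible_imp_sets[OF \<open>negligible N\<close>]] \<open>T = (T - N) \<union> N\<close>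
        by simp
      also have "\<dots> = measure lebesgue (T - N)" using negligible_imp_measure0[OF \<open>negligible N\<close>] by simp
      also have "\<dots> < r" using T r
        by (metis emeasure_eq_measure2 ennreal_less_iff measure_nonneg)
      finally show "measure lebesgue T < r" .
    qed
    \<comment> \<open>Intervals tagged in \<open>N\<close> stay in the open set \<open>T\<close> of small measure, where absolute continuity
      controls the increments; the others are handled by the derivative.\<close>
    define \<gamma> where "\<gamma> x = (if x \<in> N then T else ball x (d x))" for x
    show "\<exists>\<gamma>. gauge \<gamma> \<and> (\<forall>p. p tagged_division_of {a..b} \<and> \<gamma> fine p \<longrightarrow>
      norm ((\<Sum>(x, k)\<in>p. measure lborel k *\<^sub>R g x) - (f b - f a)) \<le> e * measure lborel {a..b})"
    proof (intro exI[of _ \<gamma>] conjI allI impI)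
      show "gauge \<gamma>" using T d(1) by (auto simp: gauge_def \<gamma>_def)
    next
      fix p assume p: "p tagged_division_of {a..b} \<and> \<gamma> fine p"
      then have ptag: "p tagged_division_of {a..b}" and fine: "\<gamma> fine p" by auto
      have finp: "finite p" using ptag by blast
      define q where "q = {(x,k)\<in>p. x \<in> N}"
      have "q \<subseteq> p" by (auto simp: q_def)
      have memE: "x \<in> k \<and> k \<subseteq> {a..b} \<and> k = {Inf k..Sup k} \<and> Inf k \<le> Sup k" if xk: "(x,k) \<in> p" for x k
      proof -
        obtain u v where "k = cbox u v" using tagged_division_ofD(4)[OF ptag xk] by blast
        moreover have "x \<in> k" "k \<subseteq> {a..b}" using tagged_division_ofD(2,3)[OF ptag that] by auto
        ultimately show ?thesis by auto
      qed
      have ba: "b - a = (\<Sum>(x,K)\<in>p. Sup K - Inf K)" "f b - f a = (\<Sum>(x,K)\<in>p. f(Sup K) - f(Inf K))"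
        using additive_tagged_division_1[where f= "\<lambda>x. x"] additive_tagged_division_1[where f= f]
            \<open>a \<le> b\<close> ptag by auto
      let ?t = "\<lambda>(x,k). measure lborel k *\<^sub>R g x - (f (Sup k) - f (Inf k))"
      have "(\<Sum>(x, k)\<in>p. measure lborel k *\<^sub>R g x) - (f b - f a) = sum ?t p"
        by (simp add: ba(2) sum_subtractf[symmetric] split_def)
      also have "\<dots> = sum ?t q + sum ?t (p - q)"
        using sum.subset_diff[OF \<open>q \<subseteq> p\<close> finp, of ?t] by simp
      finally have "norm ((\<Sum>(x, k)\<in>p. measure lborel k *\<^sub>R g x) - (f b - f a)) \<le> norm (sum ?t q) + norm (sum ?t (p - q))"
        by (simp add: norm_triangle_ineq)
      also have "norm (sum ?t q) \<le> e / 2 * (b - a)"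
      proof -
        have "norm (sum ?t q) \<le> (\<Sum>(x,k)\<in>q. \<bar>f (Sup k) - f (Inf k)\<bar>)"
          by (rule sum_norm_le) (auto simp: q_def g_def)
        also have "\<dots> < e / 2 * (b - a)"
        proof (rule abs_cont_on_sum_tags_le[OF r(2) _ _ lT mT])
          show "q tagged_partial_division_of {a..b}"
            using ptag \<open>q \<subseteq> p\<close> by (meson tagged_division_of_def tagged_partial_division_subset)
          show "k \<subseteq> T" if "(x,k) \<in> q" for x k
            using fineD[OF fine, of x k] that by (auto simp: q_def \<gamma>_def split: if_splits)
        qed auto
        finally show ?thesis by simp
      qed
      also have "norm (sum ?t (p - q)) \<le> (\<Sum>(x,k)\<in>p - q. e / 2 * (Sup k - Inf k))"
      proof (rule sum_norm_le, safe)
        fix x k assume xk: "(x, k) \<in> p" "(x, k) \<notin> q"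
        then have xN: "x \<in> {a..b} - N" using memE[OF xk(1)] by (auto simp: q_def)
        define u v where "u = Inf k" and "v = Sup k"
        have k: "k = {u..v}" "u \<le> v" "x \<in> {u..v}" "{u..v} \<subseteq> {a..b}"
          using memE[OF xk(1)] by (auto simp: u_def v_def)
        have ball: "k \<subseteq> ball x (d x)"
          using fineD[OF fine xk(1)] xN by (auto simp: \<gamma>_def)
        \<comment> \<open>Straddle argument: the tag \<open>x\<close> lies between \<open>u\<close>
          and \<open>v\<close>, so the two errors at \<open>x\<close> add up to a multiple of
          \<open>(x - u) + (v - x) = v - u\<close>.\<close>
        have "norm ((v - u) *\<^sub>R g x - (f v - f u)) = norm (f u - f x - (u - x) *\<^sub>R g x - (f v - f x - (v - x) *\<^sub>R g x))"
          by (auto simp: algebra_simps)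
        also have "\<dots> \<le> norm (f u - f x - (u - x) *\<^sub>R g x) + norm (f v - f x - (v - x) *\<^sub>R g x)"
          by (rule norm_triangle_ineq4)
        also have "\<dots> \<le> e / 2 * norm (u - x) + e / 2 * norm (v - x)"
        proof -
          have "u \<in> k" "v \<in> k" using k(1,2) by simp_all
          then have "u \<in> ball x (d x)" "v \<in> ball x (d x)" using ball by blast+
          then show ?thesis
            using k xN by (intro add_mono d(2)) (auto simp: dist_real_def abs_minus_commute)
        qed
        also have "\<dots> = e / 2 * (v - u)" using k by (auto simp: field_simps)
        finally show "norm (measure lborel k *\<^sub>R g x - (f (Sup k) - f (Inf k))) \<le> e / 2 * (Sup k - Inf k)"
          using k by simp
      qed
      also have "\<dots> \<le> (\<Sum>(x,k)\<in>p. e / 2 * (Sup k - Inf k))"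
        using memE \<open>e > 0\<close> finp by (intro sum_mono2) auto
      also have "\<dots> = e / 2 * (b - a)"
        by (simp add: ba(1) sum_distrib_left split_def)
      finally show "norm ((\<Sum>(x, k)\<in>p. measure lborel k *\<^sub>R g x) - (f b - f a)) \<le> e * measure lborel {a..b}"
        using \<open>a \<le> b\<close> by simp
    qed
  qed
  then show ?thesis
    by (rule has_integral_spike[OF \<open>negligible N\<close>, rotated]) (simp add: g_def)
qed

section \<open>Square integrable functions on the interval\<close>

lemma L2_on_mult_integrable:
  assumes f: "L2_on a b f" and g: "L2_on a b g"
  shows "integrable (lebesgue_on {a..b}) (\<lambda>x. f x * g x)"
proof (rule Bochner_Integration.integrable_bound)
  show "integrable (lebesgue_on {a..b}) (\<lambda>x. (f x)\<^sup>2 + (g x)\<^sup>2)"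
    using f g unfolding L2_on_def by auto
  show "(\<lambda>x. f x * g x) \<in> borel_measurable (lebesgue_on {a..b})"
    using f g unfolding L2_on_def by auto
  have "\<bar>x * y\<bar> \<le> x\<^sup>2 + y\<^sup>2" for x y :: real
  proof -
    have "(\<bar>x\<bar> - \<bar>y\<bar>)\<^sup>2 \<ge> 0" by simp
    then have "2 * \<bar>x * y\<bar> \<le> x\<^sup>2 + y\<^sup>2" by (simp add: power2_diff abs_mult)
    then show ?thesis using abs_ge_zero[of "x * y"] by linarith
  qed
  then show "AE x in lebesgue_on {a..b}. norm (f x * g x) \<le> norm ((f x)\<^sup>2 + (g x)\<^sup>2)"
    by simp
qed

lemma L2_on_lincomb:
  assumes f: "L2_on a b f" and g: "L2_on a b g"
  shows "L2_on a b (\<lambda>x. c * f x + d * g x)"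
proof -
  have "integrable (lebesgue_on {a..b}) (\<lambda>x. c\<^sup>2 * (f x * f x) + 2 * c * d * (f x * g x) + d\<^sup>2 * (g x * g x))"
    by (intro Bochner_Integration.integrable_add integrable_mult_right L2_on_mult_integrable assms)
  then have "integrable (lebesgue_on {a..b}) (\<lambda>x. (c * f x + d * g x)\<^sup>2)"
    by (simp add: power2_eq_square algebra_simps)
  then show ?thesis using f g unfolding L2_on_def by auto
qed

lemma continuous_on_imp_measurable_lebesgue_on:
  fixes f :: "real \<Rightarrow> real"
  assumes "continuous_on {a..b} f"
  shows "f \<in> borel_measurable (lebesgue_on {a..b})"
  using assms by (simp add: continuous_imp_measurable_on_sets_lebesgue)

lemma L2_on_mult_continuous:
  assumes f: "L2_on a b f" and w: "continuous_on {a..b} w"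
  shows "L2_on a b (\<lambda>x. f x * w x)"
proof -
  have mw: "w \<in> borel_measurable (lebesgue_on {a..b})"
    using continuous_on_imp_measurable_lebesgue_on[OF w] .
  have mf: "f \<in> borel_measurable (lebesgue_on {a..b})" using f L2_on_def by auto
  obtain B where B: "\<And>x. x \<in> {a..b} \<Longrightarrow> norm (w x) \<le> B"
    using compact_continuous_image[OF w compact_Icc] compact_imp_bounded bounded_iff
    by (metis image_eqI)
  have "integrable (lebesgue_on {a..b}) (\<lambda>x. (f x * w x)\<^sup>2)"
  proof (rule Bochner_Integration.integrable_bound)
    show "integrable (lebesgue_on {a..b}) (\<lambda>x. B\<^sup>2 * (f x)\<^sup>2)"
      using f unfolding L2_on_def by auto
    show "(\<lambda>x. (f x * w x)\<^sup>2) \<in> borel_measurable (lebesgue_on {a..b})"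
      using mf mw by auto
    have "(f x * w x)\<^sup>2 \<le> B\<^sup>2 * (f x)\<^sup>2" if "x \<in> {a..b}" for x
    proof -
      have "(w x)\<^sup>2 \<le> B\<^sup>2" using B[OF that] power_mono[of "\<bar>w x\<bar>" B 2] by simp
      then show ?thesis
        using mult_right_mono[of "(w x)\<^sup>2" "B\<^sup>2" "(f x)\<^sup>2"] by (simp add: power_mult_distrib mult.commute)
    qed
    then show "AE x in lebesgue_on {a..b}. norm ((f x * w x)\<^sup>2) \<le> norm (B\<^sup>2 * (f x)\<^sup>2)"
      by (intro AE_I2) simp
  qed
  then show ?thesis using mf mw unfolding L2_on_def by auto
qed

lemma L2_on_const: "L2_on a b (\<lambda>_. c)"
  unfolding L2_on_def
  using continuous_imp_integrable_real[of a b "\<lambda>_. c\<^sup>2"] by auto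

lemma continuous_on_imp_L2_on:
  assumes "continuous_on {a..b} w"
  shows "L2_on a b w"
  using L2_on_mult_continuous[OF L2_on_const[of a b 1] assms] by simp

lemma L2_on_imp_integrable:
  assumes "L2_on a b f"
  shows "integrable (lebesgue_on {a..b}) f"
  using L2_on_mult_integrable[OF assms L2_on_const[of a b 1]] by simp

text \<open>This rests on the completeness of Lebesgue measure, transferred to the interval through
  extension by 0. It serves derivatives, for which formulas are available only up to a null
  set.\<close>

lemma borel_measurable_lebesgue_on_cong_AE:
  fixes f g :: "real \<Rightarrow> real"
  assumes "f \<in> borel_measurable (lebesgue_on {a..b})" "AE x in lebesgue_on {a..b}. f x = g x"
  shows "g \<in> borel_measurable (lebesgue_on {a..b})"
proof -
  have "(\<lambda>x. if x \<in> {a..b} then f x else 0) \<in> borel_measurable lebesgue"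
    using borel_measurable_if_I[OF assms(1)] by simp
  moreover have "AE x in lebesgue. (if x \<in> {a..b} then f x else 0) = (if x \<in> {a..b} then g x else 0)"
    using assms(2) by (subst (asm) AE_restrict_space_iff) (auto elim: eventually_mono)
  ultimately have "(\<lambda>x. if x \<in> {a..b} then g x else 0) \<in> borel_measurable lebesgue"
    by (rule borel_measurable_AE)
  then show ?thesis by (rule borel_measurable_if_D)
qed

lemma L2_on_cong_AE:
  assumes f: "L2_on a b f" and eq: "AE x in lebesgue_on {a..b}. f x = g x"
  shows "L2_on a b g"
proof -
  have mg: "g \<in> borel_measurable (lebesgue_on {a..b})"
    using f eq borel_measurable_lebesgue_on_cong_AE unfolding L2_on_def by blast
  have "integrable (lebesgue_on {a..b}) (\<lambda>x. (g x)\<^sup>2)"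
  proof (rule integrable_cong_AE_imp)
    show "integrable (lebesgue_on {a..b}) (\<lambda>x. (f x)\<^sup>2)" using f L2_on_def by auto
    show "AE x in lebesgue_on {a..b}. (f x)\<^sup>2 = (g x)\<^sup>2" using eq by eventually_elim simp
  qed (use mg in auto)
  then show ?thesis using mg L2_on_def by auto
qed

lemma AE_lebesgue_on_imp_negligible:
  fixes P :: "real \<Rightarrow> bool"
  assumes "AE x in lebesgue_on {a..b}. P x"
  shows "negligible {x\<in>{a..b}. \<not> P x}"
proof -
  have "AE x in lebesgue. x \<in> {a..b} \<longrightarrow> P x"
    using assms by (simp add: AE_restrict_space_iff)
  then have "{x\<in>space lebesgue. \<not> (x \<in> {a..b} \<longrightarrow> P x)} \<in> null_sets lebesgue"
    by (rule completion.AE_iff_null_sets[THEN iffD1])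
  moreover have "{x\<in>space lebesgue. \<not> (x \<in> {a..b} \<longrightarrow> P x)} = {x\<in>{a..b}. \<not> P x}" by auto
  ultimately show ?thesis by (simp add: negligible_iff_null_sets)
qed

section \<open>The vector space \<open>H1\<close> and its inner product\<close>

lemma H1_D:
  assumes "f \<in> H1 a b"
  shows "continuous_on {a..b} f" "L2_on a b f" "L2_on a b (deriv f)"
    "AE x in lebesgue_on {a..b}. f differentiable (at x)"
    "f a = 0" "f b = 0" "\<And>x. x \<notin> {a..b} \<Longrightarrow> f x = 0" "abs_cont_on a b f"
  using assms abs_cont_on_imp_continuous_on unfolding H1_def by auto

text \<open>Members of \<open>H1\<close> are absolutely continuous and differentiable off a null
  set, which is what the fundamental theorem above asks for.\<close>

lemma H1_integral_deriv:
  assumes g: "g \<in> H1 a b" and xy: "a \<le> x" "x \<le> y" "y \<le> b"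
  shows "(deriv g has_integral (g y - g x)) {x..y}"
proof (rule fundamental_theorem_of_calculus_abs_cont[OF xy(2)])
  show "abs_cont_on x y g" using abs_cont_on_subset[OF H1_D(8)[OF g]] xy by simp
  let ?N = "{x\<in>{a..b}. \<not> g differentiable (at x)}"
  show "negligible ?N" using AE_lebesgue_on_imp_negligible[OF H1_D(4)[OF g]] .
  show "(g has_vector_derivative deriv g z) (at z within {x..y})" if "z \<in> {x..y} - ?N" for z
  proof -
    have "g differentiable (at z)" using that xy by auto
    then have "(g has_real_derivative deriv g z) (at z)"
      by (simp add: DERIV_deriv_iff_real_differentiable)
    then show ?thesis
      by (meson has_real_derivative_iff_has_vector_derivative has_vector_derivative_at_within)
  qed
qed

text \<open>At a point of non-differentiability \<open>deriv\<close> carries no information, so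
  linearity of the derivative is obtained almost everywhere, where both functions are
  differentiable.\<close>

lemma AE_deriv_lincomb:
  fixes f g :: "real \<Rightarrow> real"
  assumes "AE x in M. f differentiable (at x)" "AE x in M. g differentiable (at x)"
  shows "AE x in M. ((\<lambda>x. c * f x + d * g x) has_real_derivative c * deriv f x + d * deriv g x) (at x)"
  using assms
proof eventually_elim
  case (elim x)
  then have "(f has_real_derivative deriv f x) (at x)" "(g has_real_derivative deriv g x) (at x)"
    by (simp_all add: DERIV_deriv_iff_real_differentiable)
  then show ?case by (auto intro!: derivative_eq_intros)
qed

lemma H1_deriv_lincomb:
  assumes "f \<in> H1 a b" "g \<in> H1 a b"
  shows "AE x in lebesgue_on {a..b}. deriv (\<lambda>x. c * f x + d * g x) x = c * deriv f x + d * deriv g x"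
  using AE_deriv_lincomb[OF H1_D(4)[OF assms(1)] H1_D(4)[OF assms(2)], of c d]
  by eventually_elim (rule DERIV_imp_deriv)

lemma H1_lincomb:
  assumes f: "f \<in> H1 a b" and g: "g \<in> H1 a b"
  shows "(\<lambda>x. c * f x + d * g x) \<in> H1 a b"
proof -
  have "AE x in lebesgue_on {a..b}. (\<lambda>x. c * f x + d * g x) differentiable (at x)"
    using AE_deriv_lincomb[OF H1_D(4)[OF f] H1_D(4)[OF g], of c d]
    by eventually_elim (auto simp: real_differentiable_def)
  moreover have "L2_on a b (deriv (\<lambda>x. c * f x + d * g x))"
    using L2_on_lincomb[OF H1_D(3)[OF f] H1_D(3)[OF g], of c d] H1_deriv_lincomb[OF f g, of c d]
    by (auto intro: L2_on_cong_AE elim!: eventually_mono)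
  ultimately show ?thesis
    using f g abs_cont_on_lincomb L2_on_lincomb unfolding H1_def by auto
qed

text \<open>The second factor is an arbitrary square integrable function because it is later both
  the derivative of a test function and the product of a test function with the path.\<close>

lemma integral_H1_deriv_lincomb:
  assumes f: "f \<in> H1 a b" and g: "g \<in> H1 a b" and h: "L2_on a b h"
  shows "(LINT x|lebesgue_on {a..b}. deriv (\<lambda>x. c * f x + d * g x) x * h x)
    = c * (LINT x|lebesgue_on {a..b}. deriv f x * h x) + d * (LINT x|lebesgue_on {a..b}. deriv g x * h x)"
proof -
  note [intro] = L2_on_mult_integrable H1_D(3)[OF f] H1_D(3)[OF g] H1_D(3)[OF H1_lincomb[OF f g]] h
  have "(LINT x|lebesgue_on {a..b}. deriv (\<lambda>x. c * f x + d * g x) x * h x)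
      = (LINT x|lebesgue_on {a..b}. c * (deriv f x * h x) + d * (deriv g x * h x))"
  proof (rule integral_cong_AE)
    show "AE x in lebesgue_on {a..b}. deriv (\<lambda>x. c * f x + d * g x) x * h x = c * (deriv f x * h x) + d * (deriv g x * h x)"
      using H1_deriv_lincomb[OF f g, of c d] by eventually_elim (simp add: algebra_simps)
    show "(\<lambda>x. deriv (\<lambda>x. c * f x + d * g x) x * h x) \<in> borel_measurable (lebesgue_on {a..b})"
      by (rule borel_measurable_integrable) blast
    show "(\<lambda>x. c * (deriv f x * h x) + d * (deriv g x * h x)) \<in> borel_measurable (lebesgue_on {a..b})"
      by (intro borel_measurable_integrable Bochner_Integration.integrable_add integrable_mult_right) auto
  qed
  also have "\<dots> = c * (LINT x|lebesgue_on {a..b}. deriv f x * h x) + d * (LINT x|lebesgue_on {a..b}. deriv g x * h x)"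
    by (subst Bochner_Integration.integral_add) auto
  finally show ?thesis .
qed

lemma integral_lincomb:
  assumes f: "L2_on a b f" and g: "L2_on a b g" and h: "L2_on a b h"
  shows "(LINT x|lebesgue_on {a..b}. (c * f x + d * g x) * h x)
    = c * (LINT x|lebesgue_on {a..b}. f x * h x) + d * (LINT x|lebesgue_on {a..b}. g x * h x)"
proof -
  have "(LINT x|lebesgue_on {a..b}. (c * f x + d * g x) * h x)
      = (LINT x|lebesgue_on {a..b}. c * (f x * h x) + d * (g x * h x))"
    by (simp add: algebra_simps)
  also have "\<dots> = c * (LINT x|lebesgue_on {a..b}. f x * h x) + d * (LINT x|lebesgue_on {a..b}. g x * h x)"
    by (subst Bochner_Integration.integral_add) (auto intro!: L2_on_mult_integrable f g h)
  finally show ?thesis .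
qed

lemma H1_inner_lincomb:
  assumes "f \<in> H1 a b" "g \<in> H1 a b" "h \<in> H1 a b"
  shows "H1_inner a b (\<lambda>x. c * f x + d * g x) h = c * H1_inner a b f h + d * H1_inner a b g h"
  unfolding H1_inner_def
  by (simp add: integral_H1_deriv_lincomb integral_lincomb assms H1_D distrib_left)

text \<open>Both summands of the inner product are nonnegative, so \<open>f * f\<close> has integral
  0, and by continuity it vanishes on the nondegenerate interval. Off the interval \<open>f\<close>
  is 0 by the convention in \<open>H1\<close>, whence equality on the whole line.\<close>

lemma H1_inner_self_eq_0:
  assumes f: "f \<in> H1 a b" and "a < b" and 0: "H1_inner a b f f = 0"
  shows "f = (\<lambda>_. 0)"
proof -
  have "(LINT x|lebesgue_on {a..b}. deriv f x * deriv f x) \<ge> 0" "(LINT x|lebesgue_on {a..b}. f x * f x) \<ge> 0"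
    by (auto intro!: integral_nonneg_AE)
  with 0 have *: "(LINT x|lebesgue_on {a..b}. f x * f x) = 0" unfolding H1_inner_def by linarith
  have "integral {a..b} (\<lambda>x. f x * f x) = 0"
    using * lebesgue_integral_eq_integral[OF L2_on_mult_integrable[OF H1_D(2)[OF f] H1_D(2)[OF f]]] by simp
  then have "\<forall>x\<in>{a..b}. f x * f x = 0"
    using integral_eq_0_iff[OF continuous_on_mult[OF H1_D(1)[OF f] H1_D(1)[OF f]] \<open>a < b\<close>] by simp
  then have "f x = 0" for x using H1_D(7)[OF f, of x] by (cases "x \<in> {a..b}") auto
  then show ?thesis by (rule ext)
qed

section \<open>From representing elements to linear operators\<close>

text \<open>The difference \<open>u - v\<close> is itself an admissible test function.\<close>

lemma H1_representative_unique:
  assumes "a < b" "u \<in> H1 a b" "v \<in> H1 a b" "\<And>g. g \<in> H1 a b \<Longrightarrow> H1_inner a b u g = H1_inner a b v g"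
  shows "u = v"
proof -
  let ?z = "\<lambda>x. 1 * u x + (-1) * v x"
  have z: "?z \<in> H1 a b" using assms H1_lincomb by blast
  have "H1_inner a b ?z ?z = 0"
    using H1_inner_lincomb[OF assms(2,3) z, of 1 "-1"] assms(4)[OF z] by simp
  then have "?z = (\<lambda>_. 0)" using H1_inner_self_eq_0 z assms(1) by blast
  then show ?thesis by (auto simp: fun_eq_iff)
qed

text \<open>Choice turns representing elements into a map \<open>L\<close>. Its linearity is forced
  by uniqueness, since both sides of the linearity equation represent the same functional.\<close>

lemma representing_operator_exists:
  assumes "a < b"
    and rep: "\<And>f. f \<in> H1 a b \<Longrightarrow> \<exists>u\<in>H1 a b. \<forall>g\<in>H1 a b. F f g = H1_inner a b u g"
    and lin: "\<And>f g h c d. f \<in> H1 a b \<Longrightarrow> g \<in> H1 a b \<Longrightarrow> h \<in> H1 a b \<Longrightarrow>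
                F (\<lambda>x. c * f x + d * g x) h = c * F f h + d * F g h"
  shows "\<exists>L. linear_operator_on (H1 a b) L \<and> (\<forall>f\<in>H1 a b. \<forall>g\<in>H1 a b. F f g = H1_inner a b (L f) g)"
proof -
  have "\<forall>f\<in>H1 a b. \<exists>u. u \<in> H1 a b \<and> (\<forall>g\<in>H1 a b. F f g = H1_inner a b u g)"
  proof
    fix f assume "f \<in> H1 a b"
    from rep[OF this] show "\<exists>u. u \<in> H1 a b \<and> (\<forall>g\<in>H1 a b. F f g = H1_inner a b u g)"
      unfolding Bex_def .
  qed
  from bchoice[OF this] obtain L where L: "\<And>f. f \<in> H1 a b \<Longrightarrow> L f \<in> H1 a b"
     "\<And>f g. f \<in> H1 a b \<Longrightarrow> g \<in> H1 a b \<Longrightarrow> F f g = H1_inner a b (L f) g"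
    by blast
  have *: "L (\<lambda>x. c * f x + d * g x) = (\<lambda>x. c * L f x + d * L g x)" if "f \<in> H1 a b" "g \<in> H1 a b" for f g c d
    using that by (intro H1_representative_unique[OF \<open>a < b\<close>])
      (simp_all add: L(1) H1_lincomb H1_inner_lincomb lin L(2)[symmetric])
  \<comment> \<open>Coefficients 1 and 1 give additivity; second coefficient 0 gives
    homogeneity.\<close>
  have "linear_operator_on (H1 a b) L"
    unfolding linear_operator_on_def
    using L(1) *[of _ _ 1 1] *[of _ _ _ 0] by auto
  with L(2) show ?thesis by blast
qed

section \<open>Integration by parts\<close>

text \<open>Fubini on the triangle a \<le> s \<le> t \<le> b: both sides are iterated integrals of
  \<open>G s * h t\<close> over it.\<close>

lemma integral_indefinite_mult:
  fixes G h :: "real \<Rightarrow> real"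
  assumes G: "integrable (lebesgue_on {a..b}) G" and h: "integrable (lebesgue_on {a..b}) h"
  shows "(LINT t|lebesgue_on {a..b}. integral {a..t} G * h t)
    = (LINT s|lebesgue_on {a..b}. G s * integral {s..b} h)"
proof -
  let ?N = "lebesgue_on {a..b}"
  interpret N: finite_measure ?N
    by (rule finite_measure_lebesgue_on) simp
  interpret pair_sigma_finite ?N ?N ..
  have id [measurable]: "(\<lambda>x. x) \<in> borel_measurable ?N"
    by (intro continuous_on_imp_measurable_lebesgue_on continuous_intros)
  have [measurable]: "G \<in> borel_measurable ?N" "h \<in> borel_measurable ?N"
    using assms by auto
  define k where "k s t = (if s \<le> t then G s * h t else 0)" for s t
  have fs [measurable]: "fst \<in> borel_measurable (?N \<Otimes>\<^sub>M ?N)" "snd \<in> borel_measurable (?N \<Otimes>\<^sub>M ?N)"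
    using measurable_compose[OF measurable_fst id] measurable_compose[OF measurable_snd id] by auto
  \<comment> \<open>The product is integrable on the square and dominates \<open>k\<close>, which
    justifies exchanging the integrals of \<open>k\<close>.\<close>
  have Gh: "integrable (?N \<Otimes>\<^sub>M ?N) (\<lambda>(s, t). G s * h t)"
  proof (rule Fubini_integrable)
    show "(\<lambda>(s, t). G s * h t) \<in> borel_measurable (?N \<Otimes>\<^sub>M ?N)" by measurable
    show "integrable ?N (\<lambda>s. LINT t|?N. norm (case (s, t) of (s, t) \<Rightarrow> G s * h t))"
      using G by (simp add: abs_mult)
    show "AE s in ?N. integrable ?N (\<lambda>t. case (s, t) of (s, t) \<Rightarrow> G s * h t)"
      using h by simp
  qed
  have "integrable (?N \<Otimes>\<^sub>M ?N) (case_prod k)"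
  proof (rule Bochner_Integration.integrable_bound[OF Gh])
    have "(\<lambda>p. if fst p \<le> snd p then G (fst p) * h (snd p) else 0) \<in> borel_measurable (?N \<Otimes>\<^sub>M ?N)"
      by measurable
    then show "case_prod k \<in> borel_measurable (?N \<Otimes>\<^sub>M ?N)"
      by (simp add: k_def split_def)
  qed (auto simp: k_def)
  then have fubini: "(LINT t|?N. LINT s|?N. k s t) = (LINT s|?N. LINT t|?N. k s t)"
    by (rule Fubini_integral)
  have k1: "(LINT s|?N. k s t) = integral {a..t} G * h t" if t: "t \<in> {a..b}" for t
  proof -
    have "(LINT s|?N. k s t) = (LINT s|?N. (if s \<in> {a..t} then G s else 0) * h t)"
      by (rule Bochner_Integration.integral_cong) (auto simp: k_def)
    also have "\<dots> = (LINT s|?N. (if s \<in> {a..t} then G s else 0)) * h t" by simp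
    also have "(LINT s|?N. (if s \<in> {a..t} then G s else 0)) = (LINT s|lebesgue_on {a..t}. G s)"
      using t by (intro integral_restrict) auto
    also have "\<dots> = integral {a..t} G"
      using t by (intro lebesgue_integral_eq_integral integrable_subinterval[OF G]) auto
    finally show ?thesis .
  qed
  have k2: "(LINT t|?N. k s t) = G s * integral {s..b} h" if s: "s \<in> {a..b}" for s
  proof -
    have "(LINT t|?N. k s t) = (LINT t|?N. G s * (if t \<in> {s..b} then h t else 0))"
      by (rule Bochner_Integration.integral_cong) (auto simp: k_def)
    also have "\<dots> = G s * (LINT t|?N. (if t \<in> {s..b} then h t else 0))" by simp
    also have "(LINT t|?N. (if t \<in> {s..b} then h t else 0)) = (LINT t|lebesgue_on {s..b}. h t)"
      using s by (intro integral_restrict) auto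
    also have "\<dots> = integral {s..b} h"
      using s by (intro lebesgue_integral_eq_integral integrable_subinterval[OF h]) auto
    finally show ?thesis .
  qed
  have "(LINT t|?N. LINT s|?N. k s t) = (LINT t|?N. integral {a..t} G * h t)"
    by (rule Bochner_Integration.integral_cong) (use k1 in auto)
  moreover have "(LINT s|?N. LINT t|?N. k s t) = (LINT s|?N. G s * integral {s..b} h)"
    by (rule Bochner_Integration.integral_cong) (use k2 in auto)
  ultimately show ?thesis using fubini by simp
qed

text \<open>The exchange of integrals is applied with \<open>h = deriv g\<close>; since
  \<open>g b = 0\<close>, the integral of \<open>deriv g\<close> from \<open>s\<close> to
  \<open>b\<close> is \<open>- g s\<close>. In this way \<open>G\<close> may be merely
  integrable.\<close>

lemma H1_integral_by_parts:
  assumes G: "integrable (lebesgue_on {a..b}) G" and g: "g \<in> H1 a b"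
  shows "(LINT t|lebesgue_on {a..b}. integral {a..t} G * deriv g t) = - (LINT s|lebesgue_on {a..b}. G s * g s)"
proof -
  have "integral {s..b} (deriv g) = - g s" if "s \<in> {a..b}" for s
    using integral_unique[OF H1_integral_deriv[OF g, of s b]] H1_D(6)[OF g] that by auto
  then have "(LINT s|lebesgue_on {a..b}. G s * integral {s..b} (deriv g)) = (LINT s|lebesgue_on {a..b}. - (G s * g s))"
    by (intro Bochner_Integration.integral_cong) auto
  then show ?thesis
    using integral_indefinite_mult[OF G L2_on_imp_integrable[OF H1_D(3)[OF g]]] by simp
qed

section \<open>A two-point boundary value problem\<close>

text \<open>The weak form of \<open>u'' = u + \<Phi>'\<close> with zero boundary values, written as
  a first-order system because \<open>\<Phi>\<close> is only continuous.\<close>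

lemma two_point_problem_solution:
  fixes \<Phi> :: "real \<Rightarrow> real"
  assumes "a < b" and \<Phi>: "continuous_on {a..b} \<Phi>"
  obtains u p where
    "\<And>x. x \<in> {a..b} \<Longrightarrow> (u has_real_derivative p x + \<Phi> x) (at x within {a..b})"
    "\<And>x. x \<in> {a..b} \<Longrightarrow> (p has_real_derivative u x) (at x within {a..b})"
    "u a = 0" "u b = 0"
proof -
  \<comment> \<open>The system decouples: \<open>s = u + p\<close> and \<open>d = u - p\<close> satisfy \<open>s' = s + \<Phi>\<close> and \<open>d' = - d + \<Phi>\<close>.\<close>
  define A where "A x = integral {a..x} (\<lambda>t. exp (- t) * \<Phi> t)" for x
  define B where "B x = integral {a..x} (\<lambda>t. exp t * \<Phi> t)" for x
  \<comment> \<open>Variation of constants: \<open>exp x * A x\<close> and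
    \<open>exp (- x) * B x\<close> are the solutions \<open>s\<close> and \<open>d\<close> that
    vanish at \<open>a\<close>.\<close>
  have dA: "(A has_real_derivative exp (- x) * \<Phi> x) (at x within {a..b})" if "x \<in> {a..b}" for x
    unfolding A_def using that by (intro integral_has_real_derivative continuous_intros \<Phi>) auto
  have dB: "(B has_real_derivative exp x * \<Phi> x) (at x within {a..b})" if "x \<in> {a..b}" for x
    unfolding B_def using that by (intro integral_has_real_derivative continuous_intros \<Phi>) auto
  \<comment> \<open>The pair \<open>sinh (x - a)\<close>, \<open>cosh (x - a)\<close> solves the
    homogeneous system with first component 0 at \<open>a\<close>, so \<open>c\<close> is free to
    enforce \<open>u b = 0\<close>.\<close>
  define c where "c = - ((exp b * A b + exp (- b) * B b) / 2) / sinh (b - a)"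
  define u where "u x = (exp x * A x + exp (- x) * B x) / 2 + c * sinh (x - a)" for x
  define p where "p x = (exp x * A x - exp (- x) * B x) / 2 + c * cosh (x - a)" for x
  show thesis
  proof (rule that[of u p])
    fix x assume x: "x \<in> {a..b}"
    have dEA: "((\<lambda>x. exp x * A x) has_real_derivative exp x * A x + \<Phi> x) (at x within {a..b})"
      by (rule DERIV_cong[OF DERIV_mult[OF DERIV_subset[OF DERIV_exp subset_UNIV] dA[OF x]]])
        (simp add: exp_minus)
    have dEB: "((\<lambda>x. exp (- x) * B x) has_real_derivative - exp (- x) * B x + \<Phi> x) (at x within {a..b})"
      by (rule DERIV_cong[OF DERIV_mult[OF DERIV_subset[OF DERIV_fun_exp[OF DERIV_minus[OF DERIV_ident]] subset_UNIV] dB[OF x]]])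
        (simp add: exp_minus)
    have ds: "((\<lambda>x. sinh (x - a)) has_real_derivative cosh (x - a)) (at x within {a..b})"
      by (rule DERIV_cong[OF has_field_derivative_sinh[OF DERIV_diff[OF DERIV_ident DERIV_const]]]) simp
    have dc: "((\<lambda>x. cosh (x - a)) has_real_derivative sinh (x - a)) (at x within {a..b})"
      by (rule DERIV_cong[OF has_field_derivative_cosh[OF DERIV_diff[OF DERIV_ident DERIV_const]]]) simp
    show "(u has_real_derivative p x + \<Phi> x) (at x within {a..b})"
      unfolding u_def p_def
      by (rule DERIV_cong[OF DERIV_add[OF DERIV_cdivide[OF DERIV_add[OF dEA dEB]] DERIV_cmult[OF ds]]])
        (simp add: field_simps)
    show "(p has_real_derivative u x) (at x within {a..b})"
      unfolding u_def p_def
      by (rule DERIV_cong[OF DERIV_add[OF DERIV_cdivide[OF DERIV_diff[OF dEA dEB]] DERIV_cmult[OF dc]]])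
        (simp add: field_simps)
  next
    show "u a = 0" by (simp add: u_def A_def B_def)
    have "sinh (b - a) \<noteq> 0" using \<open>a < b\<close> by simp
    then show "u b = 0" by (simp add: u_def c_def)
  qed
qed

text \<open>The extension by 0 may have kinks at \<open>a\<close> and \<open>b\<close>, but these
  two points form a null set. The bounded derivative makes it Lipschitz on the interval, hence
  absolutely continuous.\<close>

lemma C1_zero_extension_in_H1:
  assumes "a < b"
    and der: "\<And>x. x \<in> {a..b} \<Longrightarrow> (u has_real_derivative u' x) (at x within {a..b})"
    and u': "continuous_on {a..b} u'" and bd: "u a = 0" "u b = 0"
  defines "v \<equiv> \<lambda>x. if x \<in> {a..b} then u x else 0"
  shows "v \<in> H1 a b" "AE x in lebesgue_on {a..b}. deriv v x = u' x"
proof -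
  have "negligible {a, b}" by simp
  then have "AE x in lebesgue. x \<notin> {a, b}"
    by (intro AE_not_in) (simp only: negligible_iff_null_sets)
  then have ab: "AE x in lebesgue_on {a..b}. x \<notin> {a, b}"
    by (subst AE_restrict_space_iff) auto
  have dv: "(v has_real_derivative u' x) (at x)" if "x \<in> {a<..<b}" for x
  proof -
    have "(u has_real_derivative u' x) (at x)"
      using der[of x] that at_within_Icc_at[of a x b] by auto
    then show ?thesis
      by (rule has_field_derivative_transform_within_open[where S = "{a<..<b}"])
        (use that in \<open>auto simp: v_def\<close>)
  qed
  have AEd: "AE x in lebesgue_on {a..b}. (v has_real_derivative u' x) (at x)"
    using ab AE_space by eventually_elim (auto intro!: dv)
  then show AE': "AE x in lebesgue_on {a..b}. deriv v x = u' x"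
    by eventually_elim (rule DERIV_imp_deriv)
  obtain B where B: "\<And>x. x \<in> {a..b} \<Longrightarrow> norm (u' x) \<le> B"
    using compact_continuous_image[OF u' compact_Icc] compact_imp_bounded bounded_iff
    by (metis image_eqI)
  have "abs_cont_on a b v"
  proof (rule lipschitz_on_imp_abs_cont_on)
    fix x y assume xy: "x \<in> {a..b}" "y \<in> {a..b}"
    have "norm (u x - u y) \<le> B * norm (x - y)"
      by (rule field_differentiable_bound[OF _ der B xy]) auto
    \<comment> \<open>The Lipschitz criterion asks for a positive constant, hence
      \<open>\<bar>B\<bar> + 1\<close> in place of \<open>B\<close>.\<close>
    also have "\<dots> \<le> (\<bar>B\<bar> + 1) * \<bar>x - y\<bar>"
      by (simp add: mult_right_mono)
    finally show "\<bar>v x - v y\<bar> \<le> (\<bar>B\<bar> + 1) * \<bar>x - y\<bar>" using xy by (simp add: v_def)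
  qed simp
  moreover have "L2_on a b v"
    using abs_cont_on_imp_continuous_on[OF \<open>abs_cont_on a b v\<close>] by (rule continuous_on_imp_L2_on)
  moreover have "AE x in lebesgue_on {a..b}. v differentiable (at x)"
    using AEd by eventually_elim (auto simp: real_differentiable_def)
  moreover have "L2_on a b (deriv v)"
    using AE' by (intro L2_on_cong_AE[OF continuous_on_imp_L2_on[OF u']]) (auto elim: eventually_mono)
  moreover have "v a = 0" "v b = 0" "\<forall>x. x \<notin> {a..b} \<longrightarrow> v x = 0"
    using bd by (auto simp: v_def)
  ultimately show "v \<in> H1 a b" unfolding H1_def by blast
qed

section \<open>Representing elements in \<open>H1\<close>\<close>

text \<open>As \<open>v' = p + \<Phi>\<close> almost everywhere, it remains to see that the integral
  of \<open>p g'\<close> is minus that of \<open>v g\<close>; this is integration by parts with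
  \<open>p' = v\<close>.\<close>

lemma H1_representative_of_continuous_functional:
  assumes "a < b" and \<Phi>: "continuous_on {a..b} \<Phi>"
  shows "\<exists>v\<in>H1 a b. \<forall>g\<in>H1 a b. (LINT t|lebesgue_on {a..b}. \<Phi> t * deriv g t) = H1_inner a b v g"
proof -
  let ?N = "lebesgue_on {a..b}"
  obtain u p where
    du: "\<And>x. x \<in> {a..b} \<Longrightarrow> (u has_real_derivative p x + \<Phi> x) (at x within {a..b})" and
    dp: "\<And>x. x \<in> {a..b} \<Longrightarrow> (p has_real_derivative u x) (at x within {a..b})" and
    bd: "u a = 0" "u b = 0"
    using two_point_problem_solution[OF assms] by blast
  have cu: "continuous_on {a..b} u" and cp: "continuous_on {a..b} p"
    using DERIV_continuous_on[of "{a..b}" u, OF du] DERIV_continuous_on[of "{a..b}" p, OF dp] by simp_all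
  define v where "v = (\<lambda>x. if x \<in> {a..b} then u x else 0)"
  have v: "v \<in> H1 a b" and dv: "AE x in ?N. deriv v x = p x + \<Phi> x"
    using C1_zero_extension_in_H1[OF \<open>a < b\<close> du continuous_on_add[OF cp \<Phi>] bd] unfolding v_def by auto
  have p: "p x - p a = integral {a..x} u" if "x \<in> {a..b}" for x
  proof -
    have "(u has_integral (p x - p a)) {a..x}"
      using that dp
      by (intro fundamental_theorem_of_calculus)
        (auto simp: has_real_derivative_iff_has_vector_derivative[symmetric]
           intro: DERIV_subset[of p _ _ "{a..b}"])
    then show ?thesis by (simp add: integral_unique)
  qed
  have "(LINT t|?N. \<Phi> t * deriv g t) = H1_inner a b v g" if g: "g \<in> H1 a b" for g
  proof -
    note [intro] = L2_on_mult_integrable H1_D(2,3)[OF g] H1_D(2,3)[OF v] continuous_on_imp_L2_on cu cp \<Phi>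
    have ig: "integrable ?N (deriv g)" using L2_on_imp_integrable[OF H1_D(3)[OF g]] .
    have "(LINT t|?N. deriv v t * deriv g t) = (LINT t|?N. p t * deriv g t + \<Phi> t * deriv g t)"
    proof (rule integral_cong_AE)
      show "AE t in ?N. deriv v t * deriv g t = p t * deriv g t + \<Phi> t * deriv g t"
        using dv by eventually_elim (simp add: algebra_simps)
    qed (auto intro!: borel_measurable_integrable Bochner_Integration.integrable_add)
    also have "\<dots> = (LINT t|?N. p t * deriv g t) + (LINT t|?N. \<Phi> t * deriv g t)"
      by (rule Bochner_Integration.integral_add) auto
    \<comment> \<open>Integration by parts is available for the indefinite integral of
      \<open>u\<close> from \<open>a\<close>, that is for \<open>p t - p a\<close>. The constant may
      be subtracted because \<open>deriv g\<close> has integral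
      \<open>g b - g a = 0\<close>.\<close>
    also have "(LINT t|?N. p t * deriv g t) = (LINT t|?N. (p t - p a) * deriv g t)"
    proof -
      have "(LINT t|?N. deriv g t) = integral {a..b} (deriv g)"
        by (rule lebesgue_integral_eq_integral[OF ig]) simp
      also have "\<dots> = 0"
        using integral_unique[OF H1_integral_deriv[OF g, of a b]] H1_D(5,6)[OF g] \<open>a < b\<close> by simp
      finally have "(LINT t|?N. p a * deriv g t) = 0" by simp
      moreover have "(LINT t|?N. (p t - p a) * deriv g t) = (LINT t|?N. p t * deriv g t) - (LINT t|?N. p a * deriv g t)"
        unfolding left_diff_distrib
        using ig by (intro Bochner_Integration.integral_diff) auto
      ultimately show ?thesis by simp
    qed
    also have "\<dots> = (LINT t|?N. integral {a..t} u * deriv g t)"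
      by (rule Bochner_Integration.integral_cong) (use p in auto)
    also have "\<dots> = - (LINT t|?N. u t * g t)"
      by (rule H1_integral_by_parts[OF continuous_imp_integrable_real[OF cu] g])
    also have "(LINT t|?N. u t * g t) = (LINT t|?N. v t * g t)"
      by (rule Bochner_Integration.integral_cong) (auto simp: v_def)
    finally show ?thesis unfolding H1_inner_def by simp
  qed
  with v show ?thesis by blast
qed

section \<open>The forms and their operators\<close>

definition weighted_form ::
    "real \<Rightarrow> real \<Rightarrow> (real \<Rightarrow> real) \<Rightarrow> real \<Rightarrow> (real \<Rightarrow> real) \<Rightarrow> (real \<Rightarrow> real) \<Rightarrow> real" where
  "weighted_form a b w \<sigma> f h =
     - (1/2) * (LINT t|lebesgue_on {a..b}. deriv f t * deriv h t)
     + (1/2) * (LINT t|lebesgue_on {a..b}. f t * deriv h t * w t)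
     + \<sigma> * (LINT t|lebesgue_on {a..b}. deriv f t * h t * w t)"

lemma form1_eq_weighted_form: "form1 a b w f h = weighted_form a b w (1/2) f h"
  by (simp add: form1_def weighted_form_def)

lemma form2_eq_weighted_form: "form2 a b w f h = weighted_form a b w (- (1/2)) f h"
  by (simp add: form2_def weighted_form_def)

lemma weighted_form_representative_exists:
  assumes "a < b" and w: "continuous_on {a..b} w" and f: "f \<in> H1 a b"
  shows "\<exists>u\<in>H1 a b. \<forall>g\<in>H1 a b. weighted_form a b w \<sigma> f g = H1_inner a b u g"
proof -
  let ?N = "lebesgue_on {a..b}"
  \<comment> \<open>The first term accounts for the third integral of the form;
    \<open>1/2 * f t\<close> compensates the integral of \<open>f g\<close> in
    \<open>-1/2 * H1_inner a b f g\<close>.\<close>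
  define G where "G t = \<sigma> * (deriv f t * w t) + 1/2 * f t" for t
  define \<Phi> where "\<Phi> x = 1/2 * (f x * w x) - integral {a..x} G" for x
  have L2fw: "L2_on a b (\<lambda>t. deriv f t * w t)"
    by (rule L2_on_mult_continuous[OF H1_D(3)[OF f] w])
  have L2G: "L2_on a b G"
    unfolding G_def by (rule L2_on_lincomb[OF L2fw H1_D(2)[OF f]])
  then have iG: "integrable ?N G" by (rule L2_on_imp_integrable)
  then have "G integrable_on {a..b}" by (rule integrable_on_lebesgue_on) simp
  then have cG: "continuous_on {a..b} (\<lambda>x. integral {a..x} G)"
    by (rule indefinite_integral_continuous_1)
  have "continuous_on {a..b} \<Phi>"
    unfolding \<Phi>_def by (intro continuous_intros cG H1_D(1)[OF f] w)
  from H1_representative_of_continuous_functional[OF \<open>a < b\<close> this] obtain v where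
    v: "v \<in> H1 a b" "\<And>g. g \<in> H1 a b \<Longrightarrow> (LINT t|?N. \<Phi> t * deriv g t) = H1_inner a b v g"
    by blast
  \<comment> \<open>\<open>v\<close> represents the form with \<open>1/2 * H1_inner a b f g\<close>
    added, which is taken off again here.\<close>
  define u where "u = (\<lambda>x. 1 * v x + (- 1/2) * f x)"
  have u: "u \<in> H1 a b" unfolding u_def by (rule H1_lincomb[OF v(1) f])
  have "weighted_form a b w \<sigma> f g = H1_inner a b u g" if g: "g \<in> H1 a b" for g
  proof -
    have fw: "L2_on a b (\<lambda>t. f t * w t)"
      by (rule L2_on_mult_continuous[OF H1_D(2)[OF f] w])
    have "(LINT t|?N. \<Phi> t * deriv g t)
        = (LINT t|?N. (1/2 * (f t * w t) + (-1) * integral {a..t} G) * deriv g t)"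
      by (simp add: \<Phi>_def)
    also have "\<dots> = 1/2 * (LINT t|?N. f t * w t * deriv g t) + (-1) * (LINT t|?N. integral {a..t} G * deriv g t)"
      by (rule integral_lincomb[OF fw continuous_on_imp_L2_on[OF cG] H1_D(3)[OF g]])
    also have "(LINT t|?N. integral {a..t} G * deriv g t) = - (LINT t|?N. G t * g t)"
      by (rule H1_integral_by_parts[OF iG g])
    also have "(LINT t|?N. G t * g t)
        = \<sigma> * (LINT t|?N. deriv f t * w t * g t) + 1/2 * (LINT t|?N. f t * g t)"
      unfolding G_def by (rule integral_lincomb[OF L2fw H1_D(2)[OF f] H1_D(2)[OF g]])
    finally have "H1_inner a b v g = 1/2 * (LINT t|?N. f t * w t * deriv g t)
        + \<sigma> * (LINT t|?N. deriv f t * w t * g t) + 1/2 * (LINT t|?N. f t * g t)"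
      using v(2)[OF g] by simp
    moreover have "H1_inner a b u g = 1 * H1_inner a b v g + (-1/2) * H1_inner a b f g"
      unfolding u_def by (rule H1_inner_lincomb[OF v(1) f g])
    moreover have "(LINT t|?N. f t * w t * deriv g t) = (LINT t|?N. f t * deriv g t * w t)"
       "(LINT t|?N. deriv f t * w t * g t) = (LINT t|?N. deriv f t * g t * w t)"
      by (simp_all add: mult.assoc mult.commute mult.left_commute)
    ultimately show ?thesis by (simp add: weighted_form_def H1_inner_def algebra_simps)
  qed
  with u show ?thesis by blast
qed

lemma weighted_form_lincomb:
  assumes w: "continuous_on {a..b} w" and f: "f \<in> H1 a b" "g \<in> H1 a b" "h \<in> H1 a b"
  shows "weighted_form a b w \<sigma> (\<lambda>x. c * f x + d * g x) h
    = c * weighted_form a b w \<sigma> f h + d * weighted_form a b w \<sigma> g h"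
proof -
  \<comment> \<open>With the integrals abstracted to variables, the claim is a polynomial
    identity.\<close>
  have alg: "- (1/2) * (c * A1 + d * B1) + (1/2) * (c * A2 + d * B2) + \<sigma> * (c * A3 + d * B3)
      = c * (- (1/2) * A1 + (1/2) * A2 + \<sigma> * A3) + d * (- (1/2) * B1 + (1/2) * B2 + \<sigma> * B3)"
    for A1 A2 A3 B1 B2 B3
    by (simp add: distrib_left algebra_simps)
  \<comment> \<open>Regrouping makes the product with the path a single square integrable factor, as
    the integral lemmas require.\<close>
  have assoc: "x * deriv h t * w t = x * (deriv h t * w t)" "x * h t * w t = x * (h t * w t)" for x t
    by simp_all
  show ?thesis
    unfolding weighted_form_def assoc
      integral_H1_deriv_lincomb[OF f(1,2) H1_D(3)[OF f(3)]]
      integral_H1_deriv_lincomb[OF f(1,2) L2_on_mult_continuous[OF H1_D(2)[OF f(3)] w]]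
      integral_lincomb[OF H1_D(2)[OF f(1)] H1_D(2)[OF f(2)] L2_on_mult_continuous[OF H1_D(3)[OF f(3)] w]]
    by (rule alg)
qed

lemma weighted_form_operator_exists:
  assumes "a < b" and w: "continuous_on {a..b} w"
  shows "\<exists>L. linear_operator_on (H1 a b) L \<and>
    (\<forall>f\<in>H1 a b. \<forall>g\<in>H1 a b. weighted_form a b w \<sigma> f g = H1_inner a b (L f) g)"
proof (rule representing_operator_exists[OF \<open>a < b\<close>])
  show "\<exists>u\<in>H1 a b. \<forall>g\<in>H1 a b. weighted_form a b w \<sigma> f g = H1_inner a b u g" if "f \<in> H1 a b" for f
    using weighted_form_representative_exists[OF assms that] .
  show "weighted_form a b w \<sigma> (\<lambda>x. c * f x + d * g x) h
      = c * weighted_form a b w \<sigma> f h + d * weighted_form a b w \<sigma> g h"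
    if "f \<in> H1 a b" "g \<in> H1 a b" "h \<in> H1 a b" for f g h c d
    using weighted_form_lincomb[OF w that] .
qed

theorem mainTheorem7:
  fixes a b :: real and M :: "'w measure" and W :: "real \<Rightarrow> 'w \<Rightarrow> real" and \<omega> :: 'w
  assumes "a < b"
    and "brownian_motion_on M a b W"
    and "\<omega> \<in> space M"
  shows "let w = (\<lambda>t. W t \<omega>) in
    (\<forall>f\<in>H1 a b. \<forall>g\<in>H1 a b. form a b w f g = form1 a b w f g + form2 a b w f g) \<and>
    (\<exists>L1 L2. linear_operator_on (H1 a b) L1 \<and> linear_operator_on (H1 a b) L2 \<and>
       (\<forall>f\<in>H1 a b. \<forall>g\<in>H1 a b. form1 a b w f g = H1_inner a b (L1 f) g) \<and>
       (\<forall>f\<in>H1 a b. \<forall>g\<in>H1 a b. form2 a b w f g = H1_inner a b (L2 f) g) \<and>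
       (\<forall>f\<in>H1 a b. \<forall>g\<in>H1 a b. form a b w f g = H1_inner a b (\<lambda>x. L1 f x + L2 f x) g))"
proof -
  define w where "w = (\<lambda>t. W t \<omega>)"
  \<comment> \<open>Path continuity, built into \<open>brownian_motion_on\<close>, makes
    \<open>w\<close> an admissible coefficient.\<close>
  have w: "continuous_on {a..b} w"
    using assms unfolding brownian_motion_on_def w_def by blast
  \<comment> \<open>The two integrals of \<open>f' g w\<close> cancel, and the halves of the others
    add up.\<close>
  have split: "form a b w f g = form1 a b w f g + form2 a b w f g" for f g
    by (simp add: form_def form1_def form2_def)
  obtain L1 where L1: "linear_operator_on (H1 a b) L1"
      "\<forall>f\<in>H1 a b. \<forall>g\<in>H1 a b. form1 a b w f g = H1_inner a b (L1 f) g"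
    using weighted_form_operator_exists[OF \<open>a < b\<close> w] unfolding form1_eq_weighted_form by blast
  obtain L2 where L2: "linear_operator_on (H1 a b) L2"
      "\<forall>f\<in>H1 a b. \<forall>g\<in>H1 a b. form2 a b w f g = H1_inner a b (L2 f) g"
    using weighted_form_operator_exists[OF \<open>a < b\<close> w] unfolding form2_eq_weighted_form by blast
  have "form a b w f g = H1_inner a b (\<lambda>x. L1 f x + L2 f x) g" if f: "f \<in> H1 a b" and g: "g \<in> H1 a b" for f g
  proof -
    have "L1 f \<in> H1 a b" "L2 f \<in> H1 a b"
      using f L1(1) L2(1) unfolding linear_operator_on_def by auto
    from H1_inner_lincomb[OF this g, of 1 1] show ?thesis
      using L1(2) L2(2) f g by (simp add: split)
  qed
  with split L1 L2 show ?thesis unfolding w_def Let_def by blast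
qed

end
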